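(* Let $\Omega\subset\mathbb{H}_1$ be a domain and let $f=(F,f_3):\Omega\to\mathbb{H}_1$ be a gradient harmonic map defined by a harmonic function $u:\Omega\to\mathbb{R}$. Then $|F|^2=|\nabla_Hu|^2$ is subharmonic, meaning that $\Delta_H|F|^2\ge0$, provided that $$Xu\,TYu-Yu\,TXu\ge0 .$$
   Context: The Heisenberg group $\mathbb{H}_1$ is $\mathbb{C}\times\mathbb{R}$ with coordinates $(x+iy,t)$ and product $(z_1,t_1)(z_2,t_2)=(z_1+z_2,\,t_1+t_2+2\,\mathrm{Im}(z_1\bar z_2))$. Put $X=\partial_x+2y\,\partial_t$, $Y=\partial_y-2x\,\partial_t$, $T=\partial_t$, $\Delta_H=X^2+Y^2$, $|\nabla_Hu|^2=(Xu)^2+(Yu)^2$. A function $u$ is harmonic if $\Delta_Hu=0$; harmonic functions are known to be real analytic. The gradient harmonic map defined by a harmonic $u$ is $f=(F,f_3)$ with $F=(Xu,Yu)$ (identified with $Xu+iYu$) and $f_3=Tu$. *)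

theory Defs
  imports "HOL-Analysis.Analysis"
begin

text \<open>The points \<open>(x + iy, t)\<close> of the Heisenberg group, with its product. As a normed space it is
  Euclidean three-space with \<open>Basis = {(1, 0), (\<i>, 0), (0, 1)}\<close>.\<close>

type_synonym heis = "complex \<times> real"

definition heis_mult :: "heis \<Rightarrow> heis \<Rightarrow> heis" where
  "heis_mult p q = (fst p + fst q, snd p + snd q + 2 * Im (fst p * cnj (fst q)))"

text \<open>\<open>partial b u p\<close> is the derivative of \<open>u\<close> at \<open>p\<close> in the coordinate direction \<open>b\<close>; it is meaningful
  only where that derivative exists.\<close>

definition partial :: "'a::euclidean_space \<Rightarrow> ('a \<Rightarrow> real) \<Rightarrow> 'a \<Rightarrow> real" where
  "partial b u p = deriv (\<lambda>s. u (p + s *\<^sub>R b)) 0"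

text \<open>Functions of class \<open>C\<^sup>k\<close>, resp. \<open>C\<^sup>\<infinity>\<close>, on an open set \<open>S\<close>; values outside \<open>S\<close> are irrelevant.\<close>

fun Ck_on :: "nat \<Rightarrow> 'a::euclidean_space set \<Rightarrow> ('a \<Rightarrow> real) \<Rightarrow> bool" where
  "Ck_on 0 S u \<longleftrightarrow> continuous_on S u"
| "Ck_on (Suc k) S u \<longleftrightarrow> u differentiable_on S \<and> (\<forall>b\<in>Basis. Ck_on k S (partial b u))"

definition smooth_on :: "'a::euclidean_space set \<Rightarrow> ('a \<Rightarrow> real) \<Rightarrow> bool" where
  "smooth_on S u \<longleftrightarrow> (\<forall>k. Ck_on k S u)"

definition XH :: "(heis \<Rightarrow> real) \<Rightarrow> heis \<Rightarrow> real" where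
  "XH u p = partial (1, 0) u p + 2 * Im (fst p) * partial (0, 1) u p"

definition YH :: "(heis \<Rightarrow> real) \<Rightarrow> heis \<Rightarrow> real" where
  "YH u p = partial (\<i>, 0) u p - 2 * Re (fst p) * partial (0, 1) u p"

definition TH :: "(heis \<Rightarrow> real) \<Rightarrow> heis \<Rightarrow> real" where
  "TH u p = partial (0, 1) u p"

definition laplace_H :: "(heis \<Rightarrow> real) \<Rightarrow> heis \<Rightarrow> real" where
  "laplace_H u p = XH (XH u) p + YH (YH u) p"

definition grad_H_sq :: "(heis \<Rightarrow> real) \<Rightarrow> heis \<Rightarrow> real" where
  "grad_H_sq u p = (XH u p)\<^sup>2 + (YH u p)\<^sup>2"

text \<open>Since \<open>\<Delta>\<^sub>H\<close> is hypoelliptic (harmonic functions are even real analytic), requiring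
  smoothness does not restrict the class of harmonic functions.\<close>

definition harmonic_H_on :: "heis set \<Rightarrow> (heis \<Rightarrow> real) \<Rightarrow> bool" where
  "harmonic_H_on \<Omega> u \<longleftrightarrow> smooth_on \<Omega> u \<and> (\<forall>p\<in>\<Omega>. laplace_H u p = 0)"

text \<open>The \<open>C\<^sup>2\<close> requirement ensures that \<open>\<Delta>\<^sub>H v\<close> is built from derivatives that exist.\<close>

definition subharmonic_H_on :: "heis set \<Rightarrow> (heis \<Rightarrow> real) \<Rightarrow> bool" where
  "subharmonic_H_on \<Omega> v \<longleftrightarrow> Ck_on 2 \<Omega> v \<and> (\<forall>p\<in>\<Omega>. laplace_H v p \<ge> 0)"

definition gradient_harmonic_map :: "heis set \<Rightarrow> (heis \<Rightarrow> real) \<Rightarrow> (heis \<Rightarrow> heis) \<Rightarrow> bool" where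
  "gradient_harmonic_map \<Omega> u f \<longleftrightarrow>
     harmonic_H_on \<Omega> u \<and> (\<forall>p\<in>\<Omega>. f p = (Complex (XH u p) (YH u p), TH u p))"

lemma partial_eq:
  assumes "(u has_derivative D) (at p)"
  shows "partial b u p = D b"
proof -
  have "((\<lambda>s. p + s *\<^sub>R b) has_derivative (\<lambda>s. s *\<^sub>R b)) (at (0::real))"
    by (auto intro!: derivative_eq_intros)
  then have "((\<lambda>s. u (p + s *\<^sub>R b)) has_derivative (\<lambda>s. D (s *\<^sub>R b))) (at 0)"
    using has_derivative_compose[of "\<lambda>s. p + s *\<^sub>R b" _ 0 UNIV u D] assms by simp
  moreover have "(\<lambda>s. D (s *\<^sub>R b)) = (\<lambda>s. D b * s)"
    using linear_scale[OF has_derivative_linear[OF assms]] by (auto simp: mult.commute)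
  ultimately show ?thesis
    unfolding partial_def by (intro DERIV_imp_deriv) (simp add: has_field_derivative_def)
qed

text \<open>\<open>X\<close>, \<open>Y\<close>, \<open>T\<close> are the left-invariant vector fields of the group: they differentiate along right
  translations by one-parameter groups
  (take \<open>(z, c)\<close> to be \<open>(1, 0)\<close>, \<open>(\<i>, 0)\<close>, \<open>(0, 1)\<close>).\<close>

lemma derivative_heis_mult:
  fixes u :: "heis \<Rightarrow> real"
  assumes "u differentiable (at p)"
  shows "((\<lambda>s. u (heis_mult p (s *\<^sub>R (z, c)))) has_real_derivative
          Re z * XH u p + Im z * YH u p + c * TH u p) (at 0)"
proof -
  obtain D where D: "(u has_derivative D) (at p)"
    using assms by (auto simp: differentiable_def)
  interpret linear D using D by (rule has_derivative_linear)
  define v :: heis where "v = (z, c + 2 * Im (fst p * cnj z))"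
  have eq: "heis_mult p (s *\<^sub>R (z, c)) = p + s *\<^sub>R v" for s
    by (simp add: heis_mult_def v_def prod_eq_iff algebra_simps)
  have "((\<lambda>s. p + s *\<^sub>R v) has_derivative (\<lambda>s. s *\<^sub>R v)) (at (0::real))"
    by (auto intro!: derivative_eq_intros)
  then have 1: "((\<lambda>s. u (p + s *\<^sub>R v)) has_derivative (\<lambda>s. D (s *\<^sub>R v))) (at 0)"
    using has_derivative_compose[of "\<lambda>s. p + s *\<^sub>R v" _ 0 UNIV u D] D by simp
  have v: "v = Re z *\<^sub>R (1, 0) + Im z *\<^sub>R (\<i>, 0) + (c + 2 * Im (fst p * cnj z)) *\<^sub>R (0, 1)"
    by (simp add: v_def prod_eq_iff complex_eq_iff)
  have "D v = Re z * D (1, 0) + Im z * D (\<i>, 0) + (c + 2 * Im (fst p * cnj z)) * D (0, 1)"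
    by (subst v) (simp add: add scale del: scaleR_Pair)
  then have "D v = Re z * XH u p + Im z * YH u p + c * TH u p"
    by (simp add: XH_def YH_def TH_def partial_eq[OF D] algebra_simps)
  moreover have "(\<lambda>s. D (s *\<^sub>R v)) = (\<lambda>s. D v * s)"
    by (auto simp: scale mult.commute)
  ultimately show ?thesis
    using 1 by (simp add: has_field_derivative_def eq del: scaleR_Pair)
qed

end

theory Submission
  imports Defs
begin

text \<open>Since \<open>[X, Y] = -4T\<close> and \<open>T\<close> is central, \<open>\<Delta>\<^sub>H Xu = X \<Delta>\<^sub>H u + 8 TYu\<close> and
  \<open>\<Delta>\<^sub>H Yu = Y \<Delta>\<^sub>H u - 8 TXu\<close>. For harmonic \<open>u\<close> the Leibniz rule
  \<open>\<Delta>\<^sub>H a\<^sup>2 = 2 |\<nabla>\<^sub>H a|\<^sup>2 + 2 a \<Delta>\<^sub>H a\<close> therefore gives the Bochner-type identity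
  \<open>\<Delta>\<^sub>H |\<nabla>\<^sub>H u|\<^sup>2 = 2 |\<nabla>\<^sub>H Xu|\<^sup>2 + 2 |\<nabla>\<^sub>H Yu|\<^sup>2 + 16 (Xu TYu - Yu TXu)\<close>.\<close>

section \<open>Partial derivatives\<close>

text \<open>The line \<open>p + s *\<^sub>R b\<close> stays in the open set for small
  \<open>s\<close>, and a derivative at 0 depends only on values near 0. This locality lets
  identities known only on \<open>S\<close> be differentiated again.\<close>

lemma partial_cong:
  assumes "open S" "p \<in> S" "\<And>q. q \<in> S \<Longrightarrow> u q = v q"
  shows "partial b u p = partial b v p"
proof -
  have "((\<lambda>s::real. p + s *\<^sub>R b) \<longlongrightarrow> p + 0 *\<^sub>R b) (nhds 0)"
    by (intro tendsto_intros filterlim_ident)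
  then have "eventually (\<lambda>s. p + s *\<^sub>R b \<in> S) (nhds 0)"
    using assms(1,2) by (auto dest: topological_tendstoD)
  then show ?thesis
    unfolding partial_def by (intro deriv_cong_ev) (auto elim: eventually_mono simp: assms(3))
qed

text \<open>\<open>partial\<close> is a derivative at parameter 0; moving the base point along the
  line gives the derivative at every parameter, the form that the mean value theorem
  requires.\<close>

lemma has_real_derivative_partial:
  assumes "u differentiable at (q + s *\<^sub>R b)"
  shows "((\<lambda>s. u (q + s *\<^sub>R b)) has_real_derivative partial b u (q + s *\<^sub>R b)) (at s within A)"
proof -
  obtain D where D: "(u has_derivative D) (at (q + s *\<^sub>R b))"
    using assms by (auto simp: differentiable_def)
  have "((\<lambda>s. q + s *\<^sub>R b) has_derivative (\<lambda>s. s *\<^sub>R b)) (at s)"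
    by (auto intro!: derivative_eq_intros)
  from has_derivative_compose[OF this D]
  have "((\<lambda>s. u (q + s *\<^sub>R b)) has_derivative (\<lambda>s. D (s *\<^sub>R b))) (at s)" .
  moreover have "(\<lambda>s. D (s *\<^sub>R b)) = (*) (D b)"
    using linear_scale[OF has_derivative_linear[OF D]] by (auto simp: mult.commute)
  ultimately show ?thesis
    using partial_eq[OF D] by (auto simp: has_field_derivative_def intro: has_derivative_at_withinI)
qed

lemma partial_const: "partial b (\<lambda>q. c) p = 0"
  by (simp add: partial_def)

lemma partial_bounded_linear:
  assumes "bounded_linear L"
  shows "partial b L p = L b"
  using assms by (intro partial_eq bounded_linear_imp_has_derivative)

lemma partial_add:
  assumes "u differentiable at p" "v differentiable at p"
  shows "partial b (\<lambda>q. u q + v q) p = partial b u p + partial b v p"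
proof -
  obtain D E where DE: "(u has_derivative D) (at p)" "(v has_derivative E) (at p)"
    using assms by (auto simp: differentiable_def)
  show ?thesis
    using partial_eq[OF has_derivative_add[OF DE]] partial_eq[OF DE(1)] partial_eq[OF DE(2)]
    by simp
qed

lemma partial_mult:
  assumes "u differentiable at p" "v differentiable at p"
  shows "partial b (\<lambda>q. u q * v q) p = partial b u p * v p + u p * partial b v p"
proof -
  obtain D E where DE: "(u has_derivative D) (at p)" "(v has_derivative E) (at p)"
    using assms by (auto simp: differentiable_def)
  show ?thesis
    using partial_eq[OF has_derivative_mult[OF DE]] partial_eq[OF DE(1)] partial_eq[OF DE(2)]
    by simp
qed

section \<open>Symmetry of mixed second derivatives\<close>

text \<open>The mean value theorem is applied twice: along \<open>b\<close> to an increment in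
  direction \<open>c\<close>, then along \<open>c\<close> to \<open>partial b u\<close>.\<close>

lemma mixed_difference_mean_value:
  fixes u :: "'a::euclidean_space \<Rightarrow> real"
  assumes "0 < s"
    and S: "\<forall>x\<in>{0..s}. \<forall>y\<in>{0..s}. p + x *\<^sub>R b + y *\<^sub>R c \<in> S"
    and u: "\<forall>q\<in>S. u differentiable at q"
    and bu: "\<forall>q\<in>S. partial b u differentiable at q"
  obtains x y where "0 \<le> x" "x \<le> s" "0 \<le> y" "y \<le> s"
    "u (p + s *\<^sub>R b + s *\<^sub>R c) - u (p + s *\<^sub>R b) - u (p + s *\<^sub>R c) + u p
     = s\<^sup>2 * partial c (partial b u) (p + x *\<^sub>R b + y *\<^sub>R c)"
proof -
  \<comment> \<open>With this choice \<open>g s - g 0\<close> is the mixed second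
    difference.\<close>
  define g where "g x = u ((p + s *\<^sub>R c) + x *\<^sub>R b) - u (p + x *\<^sub>R b)" for x
  have "(g has_real_derivative
      partial b u ((p + s *\<^sub>R c) + x *\<^sub>R b) - partial b u (p + x *\<^sub>R b)) (at x)"
    if "0 \<le> x" "x \<le> s" for x
  proof -
    have "p + x *\<^sub>R b + s *\<^sub>R c \<in> S" "p + x *\<^sub>R b + 0 *\<^sub>R c \<in> S"
      using S that \<open>0 < s\<close> by (meson atLeastAtMost_iff order_refl less_imp_le)+
    then show ?thesis
      unfolding g_def using u
      by (intro DERIV_diff has_real_derivative_partial) (auto simp: add_ac)
  qed
  from MVT2[OF \<open>0 < s\<close> this] obtain x where x: "0 < x" "x < s" and
    gx: "g s - g 0 = s * (partial b u ((p + s *\<^sub>R c) + x *\<^sub>R b) - partial b u (p + x *\<^sub>R b))"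
    by auto
  have "((\<lambda>y. partial b u ((p + x *\<^sub>R b) + y *\<^sub>R c)) has_real_derivative
      partial c (partial b u) ((p + x *\<^sub>R b) + y *\<^sub>R c)) (at y)" if "0 \<le> y" "y \<le> s" for y
    using bu S x that by (intro has_real_derivative_partial) auto
  from MVT2[OF \<open>0 < s\<close> this] obtain y where y: "0 < y" "y < s" and
    "partial b u (p + x *\<^sub>R b + s *\<^sub>R c) - partial b u (p + x *\<^sub>R b)
     = s * partial c (partial b u) (p + x *\<^sub>R b + y *\<^sub>R c)"
    by auto
  with gx have "g s - g 0 = s\<^sup>2 * partial c (partial b u) (p + x *\<^sub>R b + y *\<^sub>R c)"
    by (simp add: add_ac power2_eq_square)
  with x y show thesis
    by (intro that[of x y]) (auto simp: g_def add_ac)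
qed

text \<open>The mixed second difference is symmetric in \<open>b\<close> and \<open>c\<close>, so
  the two iterated derivatives agree when evaluated at suitable, possibly different points near
  \<open>p\<close>. Continuity of the second derivatives carries the equality to \<open>p\<close>
  itself.\<close>

lemma partial_commute:
  fixes u :: "'a::euclidean_space \<Rightarrow> real"
  assumes "open S" "p \<in> S" and u: "Ck_on 2 S u" and bc: "b \<in> Basis" "c \<in> Basis"
  shows "partial b (partial c u) p = partial c (partial b u) p"
proof -
  have diff: "\<forall>q\<in>S. u differentiable at q" "\<forall>q\<in>S. partial b u differentiable at q"
      "\<forall>q\<in>S. partial c u differentiable at q"
    using u bc \<open>open S\<close> by (auto simp: numeral_2_eq_2 differentiable_on_eq_differentiable_at)
  have cont: "isCont (partial c (partial b u)) p" "isCont (partial b (partial c u)) p"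
    using u bc \<open>p \<in> S\<close> \<open>open S\<close> by (auto simp: numeral_2_eq_2 continuous_on_eq_continuous_at)
  have "\<bar>partial b (partial c u) p - partial c (partial b u) p\<bar> \<le> e" if "0 < e" for e
  proof -
    obtain d1 where d1: "0 < d1" "\<And>q. dist q p < d1 \<Longrightarrow>
        \<bar>partial c (partial b u) q - partial c (partial b u) p\<bar> < e / 2"
      using cont(1) half_gt_zero[OF \<open>0 < e\<close>] unfolding continuous_at_eps_delta dist_real_def by blast
    obtain d2 where d2: "0 < d2" "\<And>q. dist q p < d2 \<Longrightarrow>
        \<bar>partial b (partial c u) q - partial b (partial c u) p\<bar> < e / 2"
      using cont(2) half_gt_zero[OF \<open>0 < e\<close>] unfolding continuous_at_eps_delta dist_real_def by blast
    obtain d3 where d3: "0 < d3" "ball p d3 \<subseteq> S"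
      using assms(1,2) by (auto simp: open_contains_ball)
    \<comment> \<open>Basis vectors have norm 1, so the square of side \<open>s\<close> lies within
      distance \<open>2 * s\<close> of \<open>p\<close>; dividing by 3 keeps this strictly below all
      three radii.\<close>
    define s where "s = min d1 (min d2 d3) / 3"
    have s: "0 < s" "2 * s < d1" "2 * s < d2" "2 * s < d3"
      using d1(1) d2(1) d3(1) by (auto simp: s_def)
    have near: "dist (p + x *\<^sub>R b + y *\<^sub>R c) p \<le> 2 * s"
      if "0 \<le> x" "x \<le> s" "0 \<le> y" "y \<le> s" for x y
      using norm_triangle_ineq[of "x *\<^sub>R b" "y *\<^sub>R c"] that bc by (simp add: dist_norm add.assoc)
    then have inS: "\<forall>x\<in>{0..s}. \<forall>y\<in>{0..s}. p + x *\<^sub>R b + y *\<^sub>R c \<in> S"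
      using s d3(2) by (force simp: dist_commute)
    have inS': "\<forall>x\<in>{0..s}. \<forall>y\<in>{0..s}. p + x *\<^sub>R c + y *\<^sub>R b \<in> S"
    proof (intro ballI)
      fix x y assume "x \<in> {0..s}" "y \<in> {0..s}"
      with inS have "p + y *\<^sub>R b + x *\<^sub>R c \<in> S" by blast
      then show "p + x *\<^sub>R c + y *\<^sub>R b \<in> S" by (simp add: add_ac)
    qed
    obtain x y where xy: "0 \<le> x" "x \<le> s" "0 \<le> y" "y \<le> s" and
      1: "u (p + s *\<^sub>R b + s *\<^sub>R c) - u (p + s *\<^sub>R b) - u (p + s *\<^sub>R c) + u p
        = s\<^sup>2 * partial c (partial b u) (p + x *\<^sub>R b + y *\<^sub>R c)"
      by (rule mixed_difference_mean_value[OF s(1) inS diff(1,2)])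
    obtain x' y' where xy': "0 \<le> x'" "x' \<le> s" "0 \<le> y'" "y' \<le> s" and
      2: "u (p + s *\<^sub>R c + s *\<^sub>R b) - u (p + s *\<^sub>R c) - u (p + s *\<^sub>R b) + u p
        = s\<^sup>2 * partial b (partial c u) (p + x' *\<^sub>R c + y' *\<^sub>R b)"
      by (rule mixed_difference_mean_value[OF s(1) inS' diff(1,3)])
    have "s\<^sup>2 * partial c (partial b u) (p + x *\<^sub>R b + y *\<^sub>R c)
        = s\<^sup>2 * partial b (partial c u) (p + x' *\<^sub>R c + y' *\<^sub>R b)"
      unfolding 1[symmetric] 2[symmetric] by (simp add: add_ac)
    then have "partial c (partial b u) (p + x *\<^sub>R b + y *\<^sub>R c)
        = partial b (partial c u) (p + x' *\<^sub>R c + y' *\<^sub>R b)"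
      using s(1) by simp
    moreover have "\<bar>partial c (partial b u) (p + x *\<^sub>R b + y *\<^sub>R c) - partial c (partial b u) p\<bar> < e / 2"
      using near[OF xy] s by (intro d1(2)) linarith
    moreover have "\<bar>partial b (partial c u) (p + x' *\<^sub>R c + y' *\<^sub>R b) - partial b (partial c u) p\<bar> < e / 2"
      \<comment> \<open>The coordinates are swapped: here \<open>y'\<close> belongs to
        \<open>b\<close> and \<open>x'\<close> to \<open>c\<close>.\<close>
      using near[OF xy'(3,4,1,2)] s by (intro d2(2)) (simp add: add_ac)
    ultimately show ?thesis by linarith
  qed
  then show ?thesis
    using field_le_epsilon[of "\<bar>partial b (partial c u) p - partial c (partial b u) p\<bar>" 0] by simp
qed

section \<open>Smooth functions\<close>

lemma Ck_on_Suc_imp: "Ck_on (Suc k) S u \<Longrightarrow> Ck_on k S u"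
  by (induction k arbitrary: u) (auto intro: differentiable_imp_continuous_on)

text \<open>By locality, equality on the open set passes to the partial derivatives, which drives
  the induction. The sum and product rules for \<open>partial\<close> are available only at points
  of \<open>S\<close>, so the closure proofs below rest on this transfer.\<close>

lemma Ck_on_cong:
  assumes "open S" "\<And>q. q \<in> S \<Longrightarrow> u q = v q" "Ck_on k S u"
  shows "Ck_on k S v"
  using assms(2,3)
proof (induction k arbitrary: u v)
  case 0
  then show ?case using continuous_on_cong[of S S u v] by simp
next
  case (Suc k)
  have "v differentiable_on S"
    unfolding differentiable_on_def
  proof
    fix p assume "p \<in> S"
    then show "v differentiable (at p within S)"
      using Suc.prems
      by (intro differentiable_transform_within[of u p S 1 v]) (auto simp: differentiable_on_def)
  qed
  moreover have "Ck_on k S (partial b v)" if "b \<in> Basis" for b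
  proof (rule Suc.IH)
    show "partial b u q = partial b v q" if "q \<in> S" for q
      using Suc.prems(1) by (rule partial_cong[OF \<open>open S\<close> that])
    show "Ck_on k S (partial b u)"
      using Suc.prems(2) that by simp
  qed
  ultimately show ?case by simp
qed

lemma Ck_on_const: "Ck_on k S (\<lambda>q. c)"
proof (induction k arbitrary: c)
  case (Suc k)
  have "partial b (\<lambda>q::'a. c) = (\<lambda>q. 0)" for b
    by (simp add: fun_eq_iff partial_const)
  with Suc show ?case by (simp add: differentiable_on_def)
qed simp

text \<open>The first partial derivatives are constants, so a case distinction on \<open>k\<close>
  replaces induction.\<close>

lemma Ck_on_bounded_linear:
  assumes "bounded_linear L"
  shows "Ck_on k S L"
proof (cases k)
  case 0
  then show ?thesis using assms by (simp add: linear_continuous_on)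
next
  case (Suc j)
  have "partial b L = (\<lambda>q. L b)" for b
    by (simp add: fun_eq_iff partial_bounded_linear[OF assms])
  then show ?thesis
    using Suc bounded_linear_imp_differentiable_on[OF assms] by (simp add: Ck_on_const)
qed

lemma Ck_on_add:
  assumes "open S" "Ck_on k S u" "Ck_on k S v"
  shows "Ck_on k S (\<lambda>q. u q + v q)"
  using assms(2,3)
proof (induction k arbitrary: u v)
  case 0
  then show ?case by (auto intro: continuous_on_add)
next
  case (Suc k)
  have "Ck_on k S (partial b (\<lambda>q. u q + v q))" if "b \<in> Basis" for b
  proof (rule Ck_on_cong[OF \<open>open S\<close>])
    show "Ck_on k S (\<lambda>q. partial b u q + partial b v q)"
      using Suc that by auto
    show "partial b u q + partial b v q = partial b (\<lambda>q. u q + v q) q" if "q \<in> S" for q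
      using Suc.prems that \<open>open S\<close>
      by (subst partial_add) (auto simp: differentiable_on_eq_differentiable_at)
  qed
  with Suc.prems show ?case by simp
qed

lemma Ck_on_mult:
  assumes "open S" "Ck_on k S u" "Ck_on k S v"
  shows "Ck_on k S (\<lambda>q. u q * v q)"
  using assms(2,3)
proof (induction k arbitrary: u v)
  case 0
  then show ?case by (auto intro: continuous_on_mult)
next
  case (Suc k)
  have "Ck_on k S (partial b (\<lambda>q. u q * v q))" if "b \<in> Basis" for b
  proof (rule Ck_on_cong[OF \<open>open S\<close>])
    \<comment> \<open>The product rule leaves one factor undifferentiated; its regularity is lowered
      from \<open>Suc k\<close> to \<open>k\<close> before the induction hypothesis applies.\<close>
    show "Ck_on k S (\<lambda>q. partial b u q * v q + u q * partial b v q)"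
      using Suc.prems that Ck_on_Suc_imp[OF Suc.prems(1)] Ck_on_Suc_imp[OF Suc.prems(2)]
      by (intro Ck_on_add[OF \<open>open S\<close>] Suc.IH) auto
    show "partial b u q * v q + u q * partial b v q = partial b (\<lambda>q. u q * v q) q" if "q \<in> S" for q
      using Suc.prems that \<open>open S\<close>
      by (subst partial_mult) (auto simp: differentiable_on_eq_differentiable_at)
  qed
  with Suc.prems show ?case by simp
qed

lemma smooth_on_partial:
  assumes "smooth_on S u" "b \<in> Basis"
  shows "smooth_on S (partial b u)"
  unfolding smooth_on_def
proof
  fix k
  show "Ck_on k S (partial b u)"
    using assms(1)[unfolded smooth_on_def, rule_format, of "Suc k"] assms(2) by simp
qed

lemma smooth_on_differentiable:
  assumes "smooth_on S u" "open S" "p \<in> S"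
  shows "u differentiable at p"
  using assms(1)[unfolded smooth_on_def, rule_format, of "Suc 0"] assms(2,3)
  by (simp add: differentiable_on_eq_differentiable_at)

lemma smooth_on_const: "smooth_on S (\<lambda>q. c)"
  by (simp add: smooth_on_def Ck_on_const)

lemma smooth_on_bounded_linear: "bounded_linear L \<Longrightarrow> smooth_on S L"
  by (simp add: smooth_on_def Ck_on_bounded_linear)

lemma smooth_on_add:
  "\<lbrakk>open S; smooth_on S u; smooth_on S v\<rbrakk> \<Longrightarrow> smooth_on S (\<lambda>q. u q + v q)"
  by (simp add: smooth_on_def Ck_on_add)

lemma smooth_on_mult:
  "\<lbrakk>open S; smooth_on S u; smooth_on S v\<rbrakk> \<Longrightarrow> smooth_on S (\<lambda>q. u q * v q)"
  by (simp add: smooth_on_def Ck_on_mult)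

section \<open>The horizontal vector fields\<close>

lemma heis_Basis: "(1, 0) \<in> (Basis :: heis set)" "(\<i>, 0) \<in> (Basis :: heis set)"
    "(0, 1) \<in> (Basis :: heis set)"
  by (auto simp: Basis_prod_def Basis_complex_def)

lemma bounded_linear_Re_fst: "bounded_linear (\<lambda>q::heis. Re (fst q))"
  by (intro bounded_linear_compose[OF bounded_linear_Re] bounded_linear_fst)

lemma bounded_linear_Im_fst: "bounded_linear (\<lambda>q::heis. Im (fst q))"
  by (intro bounded_linear_compose[OF bounded_linear_Im] bounded_linear_fst)

text \<open>Here and in \<open>YH_eq\<close> the field is written as a sum of products of functions,
  the difference in \<open>YH\<close> becoming a factor \<open>- 2\<close>, so that the closure
  rules for sums and products match.\<close>

lemma XH_eq: "XH u = (\<lambda>q. partial (1, 0) u q + (2 * Im (fst q)) * partial (0, 1) u q)"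
  by (simp add: XH_def fun_eq_iff)

lemma YH_eq: "YH u = (\<lambda>q. partial (\<i>, 0) u q + ((- 2) * Re (fst q)) * partial (0, 1) u q)"
  by (simp add: YH_def fun_eq_iff)

lemma TH_eq: "TH u = partial (0, 1) u"
  by (simp add: TH_def fun_eq_iff)

context
  fixes S :: "heis set"
  assumes S: "open S"
begin

lemma smooth_on_XH: "smooth_on S u \<Longrightarrow> smooth_on S (XH u)"
  unfolding XH_eq
  by (intro smooth_on_add smooth_on_mult smooth_on_partial smooth_on_const S heis_Basis
      smooth_on_bounded_linear[OF bounded_linear_Im_fst])

lemma smooth_on_YH: "smooth_on S u \<Longrightarrow> smooth_on S (YH u)"
  unfolding YH_eq
  by (intro smooth_on_add smooth_on_mult smooth_on_partial smooth_on_const S heis_Basis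
      smooth_on_bounded_linear[OF bounded_linear_Re_fst])

lemma smooth_on_TH: "smooth_on S u \<Longrightarrow> smooth_on S (TH u)"
  unfolding TH_eq by (intro smooth_on_partial heis_Basis)

lemmas smooth_on_heis = smooth_on_add[OF S] smooth_on_mult[OF S] smooth_on_const
  smooth_on_XH smooth_on_YH smooth_on_TH

section \<open>Locality, linearity and Leibniz rules for X and Y\<close>

lemma heis_fields_cong:
  assumes "p \<in> S" "\<And>q. q \<in> S \<Longrightarrow> u q = v q"
  shows "XH u p = XH v p" "YH u p = YH v p"
  using partial_cong[OF S assms] by (simp_all add: XH_def YH_def)

text \<open>Locality is used twice: the first-order derivatives agree on all of \<open>S\<close>,
  not only at \<open>p\<close>, and so can be differentiated again.\<close>

lemma laplace_H_cong:
  assumes "p \<in> S" "\<And>q. q \<in> S \<Longrightarrow> u q = v q"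
  shows "laplace_H u p = laplace_H v p"
proof -
  have "XH (XH u) p = XH (XH v) p"
    by (rule heis_fields_cong(1)[OF \<open>p \<in> S\<close>]) (rule heis_fields_cong(1)[OF _ assms(2)])
  moreover have "YH (YH u) p = YH (YH v) p"
    by (rule heis_fields_cong(2)[OF \<open>p \<in> S\<close>]) (rule heis_fields_cong(2)[OF _ assms(2)])
  ultimately show ?thesis by (simp add: laplace_H_def)
qed

lemma heis_fields_add:
  assumes "p \<in> S" "smooth_on S u" "smooth_on S v"
  shows "XH (\<lambda>q. u q + v q) p = XH u p + XH v p" "YH (\<lambda>q. u q + v q) p = YH u p + YH v p"
  using assms
  by (simp_all add: XH_def YH_def partial_add smooth_on_differentiable[OF _ S] algebra_simps)

lemma heis_fields_mult:
  assumes "p \<in> S" "smooth_on S u" "smooth_on S v"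
  shows "XH (\<lambda>q. u q * v q) p = XH u p * v p + u p * XH v p"
    "YH (\<lambda>q. u q * v q) p = YH u p * v p + u p * YH v p"
  using assms
  by (simp_all add: XH_def YH_def partial_mult smooth_on_differentiable[OF _ S] algebra_simps)

lemma heis_fields_const: "XH (\<lambda>q. c) p = 0" "YH (\<lambda>q. c) p = 0"
  by (simp_all add: XH_def YH_def partial_const)

section \<open>Commutation relations\<close>

text \<open>Second-order terms cancel by symmetry of second derivatives; what remains comes from the
  coefficients. Differentiating 2y along y gives 2T, differentiating -2x along x gives -2T, and the
  difference is 4T. No coefficient depends on t, so T commutes with X and Y.\<close>

lemma heis_commutators:
  assumes "p \<in> S" "smooth_on S u"
  shows "YH (XH u) p = XH (YH u) p + 4 * TH u p"
    "TH (XH u) p = XH (TH u) p" "TH (YH u) p = YH (TH u) p"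
proof -
  note smooth = smooth_on_partial[OF \<open>smooth_on S u\<close>]
  have lin: "bounded_linear (\<lambda>q::heis. 2 * Im (fst q))" "bounded_linear (\<lambda>q::heis. (- 2) * Re (fst q))"
    by (intro bounded_linear_const_mult bounded_linear_Re_fst bounded_linear_Im_fst)+
  have diff: "v differentiable at p" if "smooth_on S v" for v
    using smooth_on_differentiable[OF that S \<open>p \<in> S\<close>] .
  \<comment> \<open>The middle term is the derivative of the linear coefficient along
    \<open>b\<close>; among the basis directions it survives only for \<open>(\<i>, 0)\<close>, and
    in the formula for \<open>YH\<close> only for \<open>(1, 0)\<close>.\<close>
  have X: "partial b (XH u) p = partial b (partial (1, 0) u) p
      + 2 * Im (fst b) * partial (0, 1) u p + 2 * Im (fst p) * partial b (partial (0, 1) u) p" for b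
    unfolding XH_eq
    by (subst partial_add, (intro diff smooth_on_heis smooth heis_Basis smooth_on_bounded_linear lin)+,
        subst partial_mult, (intro diff smooth heis_Basis smooth_on_bounded_linear lin)+)
      (simp only: partial_bounded_linear[OF lin(1)] add.assoc)
  have Y: "partial b (YH u) p = partial b (partial (\<i>, 0) u) p
      - 2 * Re (fst b) * partial (0, 1) u p - 2 * Re (fst p) * partial b (partial (0, 1) u) p" for b
    unfolding YH_eq
    by (subst partial_add, (intro diff smooth_on_heis smooth heis_Basis smooth_on_bounded_linear lin)+,
        subst partial_mult, (intro diff smooth heis_Basis smooth_on_bounded_linear lin)+)
      (simp add: partial_bounded_linear[OF lin(2), simplified])
  have comm: "partial b (partial c u) p = partial c (partial b u) p"
    if "b \<in> Basis" "c \<in> Basis" for b c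
    using assms that by (intro partial_commute[OF S]) (auto simp: smooth_on_def)
  \<comment> \<open>Three oriented instances bring all mixed derivatives into one order, with x
    outermost and t innermost.\<close>
  note comms = comm[OF heis_Basis(2) heis_Basis(1)] comm[OF heis_Basis(3) heis_Basis(1)]
    comm[OF heis_Basis(3) heis_Basis(2)]
  show "YH (XH u) p = XH (YH u) p + 4 * TH u p"
    unfolding YH_def[of "XH u"] XH_def[of "YH u"] X Y by (simp add: comms TH_def algebra_simps)
  show "TH (XH u) p = XH (TH u) p"
    unfolding TH_def[of "XH u"] X by (simp add: comms TH_eq XH_def)
  show "TH (YH u) p = YH (TH u) p"
    unfolding TH_def[of "YH u"] Y by (simp add: comms TH_eq YH_def)
qed

section \<open>The Laplacian of horizontal derivatives, sums and squares\<close>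

text \<open>The term XXXu is common to both sides. In YYXu, moving X to the front passes two factors
  Y, and each passage contributes 4TYu because T commutes with Y.\<close>

lemma laplace_H_XH:
  assumes "p \<in> S" "smooth_on S u"
  shows "laplace_H (XH u) p = XH (laplace_H u) p + 8 * TH (YH u) p"
proof -
  note smooth = smooth_on_heis assms(2)
  \<comment> \<open>The commutator identity holds throughout \<open>S\<close>, so locality permits
    applying Y to it.\<close>
  have "YH (YH (XH u)) p = YH (\<lambda>q. XH (YH u) q + 4 * TH u q) p"
    using assms by (intro heis_fields_cong heis_commutators)
  also have "\<dots> = YH (XH (YH u)) p + 4 * YH (TH u) p"
    by (subst heis_fields_add heis_fields_mult, intro assms, (intro smooth)+)+
      (simp add: heis_fields_const)
  also have "\<dots> = XH (YH (YH u)) p + 8 * TH (YH u) p"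
    using assms by (simp add: heis_commutators smooth_on_YH)
  finally have "YH (YH (XH u)) p = XH (YH (YH u)) p + 8 * TH (YH u) p" .
  moreover have "XH (laplace_H u) p = XH (XH (XH u)) p + XH (YH (YH u)) p"
    unfolding laplace_H_def[abs_def] by (intro heis_fields_add assms(1) smooth)
  ultimately show ?thesis by (simp add: laplace_H_def)
qed

text \<open>The mirror image: YYYu is common, and moving Y to the front of XXYu passes two factors
  X, each contributing -4TXu.\<close>

lemma laplace_H_YH:
  assumes "p \<in> S" "smooth_on S u"
  shows "laplace_H (YH u) p = YH (laplace_H u) p - 8 * TH (XH u) p"
proof -
  note smooth = smooth_on_heis assms(2)
  \<comment> \<open>The difference is written with the factor \<open>- 4\<close> so that the sum and
    product rules apply.\<close>
  have "XH (XH (YH u)) p = XH (\<lambda>q. YH (XH u) q + (- 4) * TH u q) p"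
    using assms by (intro heis_fields_cong) (simp_all add: heis_commutators)
  also have "\<dots> = XH (YH (XH u)) p - 4 * XH (TH u) p"
    by (subst heis_fields_add heis_fields_mult, intro assms, (intro smooth)+)+
      (simp add: heis_fields_const)
  also have "\<dots> = YH (XH (XH u)) p - 8 * TH (XH u) p"
    using assms by (simp add: heis_commutators smooth_on_XH)
  finally have "XH (XH (YH u)) p = YH (XH (XH u)) p - 8 * TH (XH u) p" .
  moreover have "YH (laplace_H u) p = YH (XH (XH u)) p + YH (YH (YH u)) p"
    unfolding laplace_H_def[abs_def] by (intro heis_fields_add assms(1) smooth)
  ultimately show ?thesis by (simp add: laplace_H_def)
qed

lemma laplace_H_add:
  assumes "p \<in> S" "smooth_on S u" "smooth_on S v"
  shows "laplace_H (\<lambda>q. u q + v q) p = laplace_H u p + laplace_H v p"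
proof -
  have "XH (XH (\<lambda>q. u q + v q)) p = XH (\<lambda>q. XH u q + XH v q) p"
    "YH (YH (\<lambda>q. u q + v q)) p = YH (\<lambda>q. YH u q + YH v q) p"
    using assms by (intro heis_fields_cong heis_fields_add; simp)+
  then show ?thesis
    using assms by (simp add: laplace_H_def heis_fields_add smooth_on_heis)
qed

text \<open>The product rule is applied twice along each field; its cross terms form the squared
  gradient. The square is spelled as a product to fit that rule.\<close>

lemma laplace_H_square:
  assumes "p \<in> S" "smooth_on S a"
  shows "laplace_H (\<lambda>q. a q * a q) p = 2 * grad_H_sq a p + 2 * a p * laplace_H a p"
proof -
  have "XH (XH (\<lambda>q. a q * a q)) p = XH (\<lambda>q. XH a q * a q + a q * XH a q) p"
    "YH (YH (\<lambda>q. a q * a q)) p = YH (\<lambda>q. YH a q * a q + a q * YH a q) p"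
    using assms by (intro heis_fields_cong heis_fields_mult; simp)+
  then show ?thesis
    using assms
    by (simp add: laplace_H_def grad_H_sq_def heis_fields_add heis_fields_mult
        heis_fields_const smooth_on_heis power2_eq_square algebra_simps)
qed

section \<open>Bochner identity and subharmonicity\<close>

lemma smooth_on_grad_H_sq: "smooth_on S u \<Longrightarrow> smooth_on S (grad_H_sq u)"
  unfolding grad_H_sq_def[abs_def] power2_eq_square by (intro smooth_on_heis)

lemma laplace_H_grad_H_sq:
  assumes "p \<in> S" "harmonic_H_on S u"
  shows "laplace_H (grad_H_sq u) p = 2 * grad_H_sq (XH u) p + 2 * grad_H_sq (YH u) p
    + 16 * (XH u p * TH (YH u) p - YH u p * TH (XH u) p)"
proof -
  have u: "smooth_on S u" and harm: "\<And>q. q \<in> S \<Longrightarrow> laplace_H u q = 0"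
    using assms(2) by (auto simp: harmonic_H_on_def)
  \<comment> \<open>The Laplacian of \<open>u\<close> coincides with the zero function on a
    neighbourhood of \<open>p\<close>, so its derivatives at \<open>p\<close> vanish as
    well.\<close>
  have "XH (laplace_H u) p = 0" "YH (laplace_H u) p = 0"
    using heis_fields_cong[OF \<open>p \<in> S\<close> harm] by (simp_all add: heis_fields_const)
  then have "laplace_H (XH u) p = 8 * TH (YH u) p" "laplace_H (YH u) p = - 8 * TH (XH u) p"
    by (simp_all add: laplace_H_XH laplace_H_YH \<open>p \<in> S\<close> u)
  \<comment> \<open>The factor 16 is the 2 from the Laplacian of a square times the 8 from the
    commutators.\<close>
  then show ?thesis
    unfolding grad_H_sq_def[of u, abs_def] power2_eq_square
    by (simp add: laplace_H_add laplace_H_square \<open>p \<in> S\<close> u smooth_on_heis algebra_simps)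
qed

end

theorem corollary7p12:
  fixes \<Omega> :: "heis set" and u :: "heis \<Rightarrow> real" and f :: "heis \<Rightarrow> heis"
  assumes "open \<Omega>" and "connected \<Omega>" and "\<Omega> \<noteq> {}"
    and "gradient_harmonic_map \<Omega> u f"
    and "\<forall>p\<in>\<Omega>. XH u p * TH (YH u) p - YH u p * TH (XH u) p \<ge> 0"
  shows "(\<forall>p\<in>\<Omega>. (cmod (fst (f p)))\<^sup>2 = grad_H_sq u p) \<and>
         subharmonic_H_on \<Omega> (\<lambda>p. (cmod (fst (f p)))\<^sup>2)"
proof -
  have harm: "harmonic_H_on \<Omega> u"
    using assms(4) by (simp add: gradient_harmonic_map_def)
  have eq: "(cmod (fst (f p)))\<^sup>2 = grad_H_sq u p" if "p \<in> \<Omega>" for p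
    using assms(4) that by (simp add: gradient_harmonic_map_def grad_H_sq_def cmod_power2)
  have "Ck_on 2 \<Omega> (grad_H_sq u)"
    using harm smooth_on_grad_H_sq[OF \<open>open \<Omega>\<close>] by (auto simp: harmonic_H_on_def smooth_on_def)
  \<comment> \<open>The map \<open>f\<close> is prescribed only on \<Omega>, so regularity, and
    below the Laplacian, are transferred by locality.\<close>
  then have "Ck_on 2 \<Omega> (\<lambda>p. (cmod (fst (f p)))\<^sup>2)"
    by (rule Ck_on_cong[OF \<open>open \<Omega>\<close>, rotated]) (simp add: eq)
  moreover have "laplace_H (\<lambda>p. (cmod (fst (f p)))\<^sup>2) p \<ge> 0" if "p \<in> \<Omega>" for p
  proof -
    have "laplace_H (\<lambda>p. (cmod (fst (f p)))\<^sup>2) p = laplace_H (grad_H_sq u) p"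
      using eq by (rule laplace_H_cong[OF \<open>open \<Omega>\<close> that])
    \<comment> \<open>This disposes of the two gradient terms of the Bochner identity; the remaining
      term is 16 times the quantity assumed nonnegative.\<close>
    moreover have "grad_H_sq v p \<ge> 0" for v
      by (simp add: grad_H_sq_def)
    ultimately show ?thesis
      using assms(5) that by (simp add: laplace_H_grad_H_sq[OF \<open>open \<Omega>\<close> that harm])
  qed
  ultimately show ?thesis
    using eq by (simp add: subharmonic_H_on_def)
qed

end
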